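(* Let $G$ be a doubly regular tournament with $v$ vertices and let $\Gamma$ be a transitive subtournament of size $s$ in $G$. Then $$s\le\frac{-3+\sqrt{13+12v}}{2}.$$
   Context: A tournament is a finite digraph $G=(V,E)$ such that for any two distinct vertices $x,y$ exactly one of $(x,y)\in E$, $(y,x)\in E$ holds, and $(x,x)\notin E$ for all $x$. A vertex $x$ dominates $y$ if $(x,y)\in E$. A tournament with $v$ vertices is doubly regular if every vertex has in-degree and out-degree $(v-1)/2$ and the number of vertices dominated simultaneously by both vertices of a pair of two distinct vertices is a constant not depending on the choice of the pair (this constant is then $(v-3)/4$). A transitive tournament is a tournament such that $(x,y)\in E$ and $(y,z)\in E$ imply $(x,z)\in E$. A transitive subtournament of size $s$ in $G$ is an induced sub-digraph of $G$ on $s$ vertices which is a transitive tournament. *)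

theory Defs
  imports Complex_Main "Graph_Theory.Digraph_Component"
begin

text \<open>
  The locale \<^locale>\<open>digraph\<close> already provides finiteness and the absence of loops and of
  parallel arcs, so that \<open>arcs_ends G\<close> plays the role of the edge relation \<open>E\<close>.
\<close>

locale tournament = digraph +
  assumes exactly_one_arc:
    "\<lbrakk>x \<in> verts G; y \<in> verts G; x \<noteq> y\<rbrakk> \<Longrightarrow> (x \<rightarrow>\<^bsub>G\<^esub> y) \<longleftrightarrow> \<not> (y \<rightarrow>\<^bsub>G\<^esub> x)"

locale transitive_tournament = tournament +
  assumes trans_arcs: "trans (arcs_ends G)"

text \<open>
  The degree conditions are stated over the reals, so that \<open>(v - 1) / 2\<close> is the exact quotient.
\<close>

locale doubly_regular_tournament = tournament +
  assumes regular_in: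
    "x \<in> verts G \<Longrightarrow> real (in_degree G x) = (real (card (verts G)) - 1) / 2"
  and regular_out:
    "x \<in> verts G \<Longrightarrow> real (out_degree G x) = (real (card (verts G)) - 1) / 2"
  and constant_common_dominated:
    "\<exists>c. \<forall>x \<in> verts G. \<forall>y \<in> verts G. x \<noteq> y \<longrightarrow>
       card {z \<in> verts G. x \<rightarrow>\<^bsub>G\<^esub> z \<and> y \<rightarrow>\<^bsub>G\<^esub> z} = c"

definition transitive_subtournament :: "('a, 'b) pre_digraph \<Rightarrow> ('a, 'b) pre_digraph \<Rightarrow> bool" where
  "transitive_subtournament \<Gamma> G \<longleftrightarrow> induced_subgraph \<Gamma> G \<and> transitive_tournament \<Gamma>"

end

theory Submission
  imports Defs
begin

text \<open>
  Let \<open>S\<close> be the skew matrix with entries \<open>1\<close>, \<open>-1\<close> and \<open>0\<close> describing the arcs of \<open>G\<close>. Double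
  regularity amounts to \<open>S S\<^sup>T = v I - J\<close>, so the indicator vector of any vertex set \<open>X\<close> of size
  \<open>s\<close> is mapped by \<open>S\<close> to a vector of squared norm \<open>v s - s\<^sup>2\<close>. If \<open>X\<close> induces a transitive
  tournament, then the coordinates of that vector at \<open>X\<close> are \<open>s - 1, s - 3, \<dots>, 1 - s\<close>, whose
  squares already add up to \<open>s (s\<^sup>2 - 1) / 3\<close>. Hence \<open>s\<^sup>2 + 3 s - 1 \<le> 3 v\<close>.
\<close>

definition arc_sign :: "('a, 'b) pre_digraph \<Rightarrow> 'a \<Rightarrow> 'a \<Rightarrow> real" where
  "arc_sign G x y = of_bool (x \<rightarrow>\<^bsub>G\<^esub> y) - of_bool (y \<rightarrow>\<^bsub>G\<^esub> x)"

section \<open>Degrees as numbers of neighbours\<close>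

lemma (in digraph) out_degree_eq_card:
  "out_degree G x = card {y \<in> verts G. x \<rightarrow>\<^bsub>G\<^esub> y}"
proof -
  have "bij_betw (head G) (out_arcs G x) {y \<in> verts G. x \<rightarrow>\<^bsub>G\<^esub> y}"
  proof (intro bij_betw_imageI)
    show "inj_on (head G) (out_arcs G x)"
      by (auto intro!: inj_onI no_multi_arcs simp: arc_to_ends_def)
    show "head G ` out_arcs G x = {y \<in> verts G. x \<rightarrow>\<^bsub>G\<^esub> y}"
      by (force simp: arcs_ends_conv)
  qed
  then show ?thesis
    unfolding out_degree_def by (rule bij_betw_same_card)
qed

lemma (in digraph) in_degree_eq_card:
  "in_degree G x = card {y \<in> verts G. y \<rightarrow>\<^bsub>G\<^esub> x}"
proof -
  have "bij_betw (tail G) (in_arcs G x) {y \<in> verts G. y \<rightarrow>\<^bsub>G\<^esub> x}"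
  proof (intro bij_betw_imageI)
    show "inj_on (tail G) (in_arcs G x)"
      by (auto intro!: inj_onI no_multi_arcs simp: arc_to_ends_def)
    show "tail G ` in_arcs G x = {y \<in> verts G. y \<rightarrow>\<^bsub>G\<^esub> x}"
      by (force simp: arcs_ends_conv)
  qed
  then show ?thesis
    unfolding in_degree_def by (rule bij_betw_same_card)
qed

lemma sum_of_bool_eq_card:
  "finite A \<Longrightarrow> (\<Sum>x\<in>A. of_bool (P x)) = real (card {x \<in> A. P x})"
  by (simp add: Collect_conj_eq Int_commute)

section \<open>Products of rows of the sign matrix\<close>

context tournament
begin

text \<open>With a single arc indicator per entry, products of entries reduce to out-degrees and
  common out-neighbours. The last summand repairs the diagonal, where the others give -1.\<close>

lemma arc_sign_eq:
  assumes "x \<in> verts G" "y \<in> verts G"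
  shows "arc_sign G x y = 2 * of_bool (x \<rightarrow>\<^bsub>G\<^esub> y) - 1 + of_bool (x = y)"
  using exactly_one_arc[OF assms] adj_not_same by (auto simp: arc_sign_def)

lemma sum_arc_sign:
  "(\<Sum>x\<in>verts G. arc_sign G x z) = real (in_degree G z) - real (out_degree G z)"
  unfolding arc_sign_def in_degree_eq_card out_degree_eq_card
  by (simp only: sum_subtractf sum_of_bool_eq_card finite_verts)

lemma sum_arc_sign_square:
  assumes x: "x \<in> verts G"
  shows "(\<Sum>z\<in>verts G. arc_sign G x z * arc_sign G x z) = real (card (verts G)) - 1"
proof -
  have "(\<Sum>z\<in>verts G. arc_sign G x z * arc_sign G x z) = (\<Sum>z\<in>verts G. 1 - of_bool (x = z))"
    using exactly_one_arc[OF x] adj_not_same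
    by (intro sum.cong) (auto simp: arc_sign_def)
  then show ?thesis
    using x by (simp add: sum_subtractf of_bool_def)
qed

lemma sum_arc_sign_mult:
  assumes x: "x \<in> verts G" and y: "y \<in> verts G" and "x \<noteq> y"
  shows "(\<Sum>z\<in>verts G. arc_sign G x z * arc_sign G y z) =
    4 * real (card {z \<in> verts G. x \<rightarrow>\<^bsub>G\<^esub> z \<and> y \<rightarrow>\<^bsub>G\<^esub> z})
    - 2 * real (out_degree G x) - 2 * real (out_degree G y) + real (card (verts G))"
proof -
  \<comment> \<open>Expanding the product with \<open>arc_sign_eq\<close> leaves diagonal
    corrections only at z = x and z = y; these two cancel in the end, as the sign matrix is
    skew.\<close>
  have "(\<Sum>z\<in>verts G. arc_sign G x z * arc_sign G y z) =
    (\<Sum>z\<in>verts G. 4 * of_bool (x \<rightarrow>\<^bsub>G\<^esub> z \<and> y \<rightarrow>\<^bsub>G\<^esub> z) - 2 * of_bool (x \<rightarrow>\<^bsub>G\<^esub> z)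
      - 2 * of_bool (y \<rightarrow>\<^bsub>G\<^esub> z) + 1
      + (if x = z then arc_sign G y x else 0) + (if y = z then arc_sign G x y else 0))"
    using x y \<open>x \<noteq> y\<close> adj_not_same
    by (intro sum.cong refl) (auto simp: arc_sign_eq)
  also have "\<dots> = 4 * real (card {z \<in> verts G. x \<rightarrow>\<^bsub>G\<^esub> z \<and> y \<rightarrow>\<^bsub>G\<^esub> z})
    - 2 * real (out_degree G x) - 2 * real (out_degree G y) + real (card (verts G))
    + arc_sign G y x + arc_sign G x y"
    using x y unfolding out_degree_eq_card sum_of_bool_eq_card[OF finite_verts, symmetric]
    by (simp add: sum.distrib sum_subtractf sum_distrib_left del: sum_of_bool_eq)
  finally show ?thesis
    by (simp add: arc_sign_def)
qed

end

section \<open>Squared norms through inner products of rows\<close>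

lemma sum_square_sum_swap:
  fixes f :: "'a \<Rightarrow> 'b \<Rightarrow> real"
  shows "(\<Sum>z\<in>A. (\<Sum>x\<in>X. f x z)\<^sup>2) = (\<Sum>x\<in>X. \<Sum>y\<in>X. \<Sum>z\<in>A. f x z * f y z)"
proof -
  have "(\<Sum>z\<in>A. (\<Sum>x\<in>X. f x z)\<^sup>2) = (\<Sum>z\<in>A. \<Sum>x\<in>X. \<Sum>y\<in>X. f x z * f y z)"
    by (simp add: power2_eq_square sum_product)
  also have "\<dots> = (\<Sum>x\<in>X. \<Sum>z\<in>A. \<Sum>y\<in>X. f x z * f y z)"
    by (rule sum.swap)
  also have "\<dots> = (\<Sum>x\<in>X. \<Sum>y\<in>X. \<Sum>z\<in>A. f x z * f y z)"
    by (intro sum.cong refl sum.swap)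
  finally show ?thesis .
qed

lemma sum_two_valued:
  fixes a b :: real
  assumes "finite X"
  shows "(\<Sum>x\<in>X. \<Sum>y\<in>X. if x = y then a else b) =
    real (card X) * a + real (card X) * (real (card X) - 1) * b"
proof -
  have "(\<Sum>y\<in>X. if x = y then a else b) = a + (real (card X) - 1) * b" if "x \<in> X" for x
  proof -
    have "(\<Sum>y\<in>X. if x = y then a else b) = (\<Sum>y\<in>X. (if x = y then a - b else 0) + b)"
      by (intro sum.cong) auto
    then show ?thesis
      using assms that by (simp add: sum.distrib algebra_simps)
  qed
  then have "(\<Sum>x\<in>X. \<Sum>y\<in>X. if x = y then a else b) = (\<Sum>x\<in>X. a + (real (card X) - 1) * b)"
    by (rule sum.cong[OF refl])
  then show ?thesis
    by (simp add: algebra_simps)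
qed

section \<open>Doubly regular tournaments\<close>

context doubly_regular_tournament
begin

text \<open>
  The constant inner product of two distinct rows is found from \<open>S \<one> = 0\<close>, which forces the
  entries of \<open>S S\<^sup>T\<close> to add up to \<open>0\<close>.
\<close>

lemma sum_arc_sign_mult_eq:
  assumes x: "x \<in> verts G" and y: "y \<in> verts G" and "x \<noteq> y"
  shows "(\<Sum>z\<in>verts G. arc_sign G x z * arc_sign G y z) = -1"
proof -
  define v where "v = real (card (verts G))"
  obtain q where q: "(\<Sum>z\<in>verts G. arc_sign G x z * arc_sign G y z) = q"
    if "x \<in> verts G" "y \<in> verts G" "x \<noteq> y" for x y
  proof -
    obtain c where "card {z \<in> verts G. x \<rightarrow>\<^bsub>G\<^esub> z \<and> y \<rightarrow>\<^bsub>G\<^esub> z} = c"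
      if "x \<in> verts G" "y \<in> verts G" "x \<noteq> y" for x y
      using constant_common_dominated by blast
    \<comment> \<open>With both out-degrees (v - 1) / 2, the product is 4 c - 2 (v - 1) + v.\<close>
    then show thesis
      by (intro that[of "4 * real c - v + 2"])
        (simp add: sum_arc_sign_mult regular_out v_def field_simps)
  qed
  have "0 = (\<Sum>z\<in>verts G. (\<Sum>x\<in>verts G. arc_sign G x z)\<^sup>2)"
    by (simp add: sum_arc_sign regular_in regular_out)
  also have "\<dots> = (\<Sum>x\<in>verts G. \<Sum>y\<in>verts G. if x = y then v - 1 else q)"
    unfolding sum_square_sum_swap
    by (intro sum.cong refl) (auto simp: sum_arc_sign_square q v_def)
  also have "\<dots> = v * (v - 1) * (1 + q)"
    by (simp add: sum_two_valued v_def algebra_simps)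
  finally have "v * (v - 1) * (1 + q) = 0"
    by simp
  \<comment> \<open>Two distinct vertices exclude the roots v = 0 and v = 1, so the factor 1 + q
    vanishes.\<close>
  moreover have "v \<ge> 2"
    using card_mono[of "verts G" "{x, y}"] assms by (simp add: v_def)
  ultimately have "q = -1"
    by auto
  then show ?thesis
    using q assms by blast
qed

text \<open>Summing over the first index applies the transpose -S instead of S, a sign that the
  squares absorb.\<close>

lemma sum_square_arc_sign_subset:
  assumes "X \<subseteq> verts G"
  shows "(\<Sum>z\<in>verts G. (\<Sum>x\<in>X. arc_sign G x z)\<^sup>2) =
    real (card X) * (real (card (verts G)) - real (card X))"
proof -
  have "finite X"
    using assms finite_verts by (rule finite_subset)
  have "(\<Sum>z\<in>verts G. (\<Sum>x\<in>X. arc_sign G x z)\<^sup>2) =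
      (\<Sum>x\<in>X. \<Sum>y\<in>X. if x = y then real (card (verts G)) - 1 else -1)"
    unfolding sum_square_sum_swap
    using subsetD[OF assms]
    by (intro sum.cong refl) (auto simp: sum_arc_sign_square sum_arc_sign_mult_eq)
  then show ?thesis
    by (simp add: sum_two_valued[OF \<open>finite X\<close>] algebra_simps)
qed

end

text \<open>The offset \<open>c\<close> is kept independent of \<open>n\<close>: its later value s -
  1 would otherwise vary along the induction.\<close>

lemma sum_square_progression:
  fixes c :: real
  shows "(\<Sum>i<n. (2 * real i - c)\<^sup>2) =
    real n * (2 * (real n - 1) * (2 * real n - 1) - 6 * c * (real n - 1) + 3 * c\<^sup>2) / 3"
proof (induction n)
  case (Suc n)
  \<comment> \<open>The new term is the difference of the closed forms at x + 1 and x.\<close>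
  have "(2 * x - c)\<^sup>2 = ((x + 1) * (2 * x * (2 * x + 1) - 6 * c * x + 3 * c\<^sup>2)
      - x * (2 * (x - 1) * (2 * x - 1) - 6 * c * (x - 1) + 3 * c\<^sup>2)) / 3" for x :: real
    by algebra
  from this[of "real n"] show ?case
    by (simp add: Suc add.commute diff_divide_distrib)
qed simp

section \<open>Transitive tournaments\<close>

context transitive_tournament
begin

text \<open>By transitivity, an arc from x to y puts the in-neighbours of x among those of y,
  properly since x itself is new. In-degrees thus increase along arcs, hence are distinct, and being
  below the number of vertices they take every such value once.\<close>

lemma bij_betw_in_degree: "bij_betw (in_degree G) (verts G) {..<card (verts G)}"
proof -
  let ?P = "\<lambda>x. {y \<in> verts G. y \<rightarrow>\<^bsub>G\<^esub> x}"
  have less: "in_degree G x < in_degree G y" if "x \<rightarrow>\<^bsub>G\<^esub> y" for x y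
  proof -
    have "?P x \<subset> ?P y"
      using that trans_arcs adj_not_same adj_in_verts by (blast dest: transD)
    then show ?thesis
      by (simp add: in_degree_eq_card psubset_card_mono)
  qed
  have "inj_on (in_degree G) (verts G)"
    using less exactly_one_arc by (metis inj_onI less_irrefl)
  moreover have "in_degree G ` verts G \<subseteq> {..<card (verts G)}"
  proof clarsimp
    fix x assume "x \<in> verts G"
    then have "?P x \<subset> verts G"
      using adj_not_same by blast
    then show "in_degree G x < card (verts G)"
      by (simp add: in_degree_eq_card psubset_card_mono)
  qed
  ultimately show ?thesis
    by (simp add: bij_betw_def card_image card_subset_eq)
qed

lemma sum_square_arc_sign:
  "(\<Sum>z\<in>verts G. (\<Sum>x\<in>verts G. arc_sign G x z)\<^sup>2) =
    real (card (verts G)) * ((real (card (verts G)))\<^sup>2 - 1) / 3"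
proof -
  let ?s = "card (verts G)"
  \<comment> \<open>In-degree minus out-degree, where the two degrees add up to s - 1.\<close>
  have "(\<Sum>x\<in>verts G. arc_sign G x z) = 2 * real (in_degree G z) - (real ?s - 1)"
    if z: "z \<in> verts G" for z
  proof -
    have "(\<Sum>x\<in>verts G. arc_sign G x z) =
        (\<Sum>x\<in>verts G. 2 * of_bool (x \<rightarrow>\<^bsub>G\<^esub> z) - 1 + (if z = x then 1 else 0))"
      using z by (intro sum.cong) (auto simp: arc_sign_eq)
    also have "\<dots> = 2 * real (in_degree G z) - (real ?s - 1)"
      using z unfolding in_degree_eq_card sum_of_bool_eq_card[OF finite_verts, symmetric]
      by (simp add: sum.distrib sum_subtractf sum_distrib_left del: sum_of_bool_eq)
    finally show ?thesis .
  qed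
  then have "(\<Sum>z\<in>verts G. (\<Sum>x\<in>verts G. arc_sign G x z)\<^sup>2) =
      (\<Sum>z\<in>verts G. (2 * real (in_degree G z) - (real ?s - 1))\<^sup>2)"
    by simp
  also have "\<dots> = (\<Sum>i<?s. (2 * real i - (real ?s - 1))\<^sup>2)"
    by (rule sum.reindex_bij_betw[OF bij_betw_in_degree])
  also have "\<dots> = real ?s * ((real ?s)\<^sup>2 - 1) / 3"
    unfolding sum_square_progression by algebra
  finally show ?thesis .
qed

end

lemma dominates_induced_subgraph:
  assumes "induced_subgraph H G" "x \<in> verts H" "y \<in> verts H"
  shows "x \<rightarrow>\<^bsub>H\<^esub> y \<longleftrightarrow> x \<rightarrow>\<^bsub>G\<^esub> y"
proof -
  have "tail H = tail G" "head H = head G"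
    and "arcs H = {e \<in> arcs G. tail G e \<in> verts H \<and> head G e \<in> verts H}"
    using assms(1) by (simp_all add: induced_subgraph_def subgraph_def compatible_def)
  then show ?thesis
    using assms(2,3) by (auto simp only: arcs_ends_conv image_iff mem_Collect_eq prod.inject)
qed

theorem corollary4p6:
  fixes G \<Gamma> :: "('a, 'b) pre_digraph" and v s :: nat
  assumes "doubly_regular_tournament G"
    and "card (verts G) = v"
    and "transitive_subtournament \<Gamma> G"
    and "card (verts \<Gamma>) = s"
  shows "real s \<le> (-3 + sqrt (13 + 12 * real v)) / 2"
proof -
  interpret G: doubly_regular_tournament G by fact
  interpret \<Gamma>: transitive_tournament \<Gamma>
    using assms(3) by (simp add: transitive_subtournament_def)
  have ind: "induced_subgraph \<Gamma> G"
    using assms(3) by (simp add: transitive_subtournament_def)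
  then have sub: "verts \<Gamma> \<subseteq> verts G"
    by (auto simp: induced_subgraph_def)
  have "x \<rightarrow>\<^bsub>\<Gamma>\<^esub> z \<longleftrightarrow> x \<rightarrow>\<^bsub>G\<^esub> z" if "x \<in> verts \<Gamma>" "z \<in> verts \<Gamma>" for x z
    using ind that by (rule dominates_induced_subgraph)
  then have sign: "arc_sign \<Gamma> x z = arc_sign G x z" if "x \<in> verts \<Gamma>" "z \<in> verts \<Gamma>" for x z
    using that by (simp add: arc_sign_def)
  have "real s * (((real s)\<^sup>2 - 1) / 3) = (\<Sum>z\<in>verts \<Gamma>. (\<Sum>x\<in>verts \<Gamma>. arc_sign \<Gamma> x z)\<^sup>2)"
    unfolding \<Gamma>.sum_square_arc_sign assms(4) by (rule times_divide_eq_right)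
  also have "\<dots> = (\<Sum>z\<in>verts \<Gamma>. (\<Sum>x\<in>verts \<Gamma>. arc_sign G x z)\<^sup>2)"
    by (simp add: sign)
  \<comment> \<open>The only estimate: the squares at vertices outside \<Gamma> are dropped.\<close>
  also have "\<dots> \<le> (\<Sum>z\<in>verts G. (\<Sum>x\<in>verts \<Gamma>. arc_sign G x z)\<^sup>2)"
    using sub by (intro sum_mono2) auto
  also have "\<dots> = real s * (real v - real s)"
    unfolding G.sum_square_arc_sign_subset[OF sub] assms(2,4) ..
  finally have *: "real s * (((real s)\<^sup>2 - 1) / 3) \<le> real s * (real v - real s)" .
  \<comment> \<open>The factor s can be cancelled only if it is nonzero; for s = 0 the claim reads
    -1 \<le> 3 v.\<close>
  have "(real s)\<^sup>2 - 1 \<le> 3 * (real v - real s)"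
  proof (cases "s = 0")
    case False
    then show ?thesis
      using mult_left_le_imp_le[OF *] by simp
  qed simp
  \<comment> \<open>Multiply by 4 and complete the square.\<close>
  then have "(2 * real s + 3)\<^sup>2 \<le> 13 + 12 * real v"
    by (simp add: power2_eq_square algebra_simps)
  then have "2 * real s + 3 \<le> sqrt (13 + 12 * real v)"
    by (rule real_le_rsqrt)
  then show ?thesis
    by simp
qed

end
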